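(* Let $n\ge 1$ be an integer, let $a_0,a_1,\dots,a_{n-1}\in\mathbb{H}$ be quaternions, and let $f(q)=q^{n}+a_{n-1}q^{n-1}+\cdots+a_{1}q+a_{0}$ be the corresponding polynomial of degree $n$ in the quaternionic variable $q$. Then all the zeros of $f$ (i.e. all $q\in\mathbb{H}$ with $f(q)=0$) lie in the ball $$|q|\le\max\left(L,\,L^{\frac{1}{n}}\right),\qquad\text{where } L=|a_0|+|a_1|+\cdots+|a_{n-1}|.$$
   Context: $\mathbb{H}=\{\alpha+\beta i+\gamma j+\delta k:\alpha,\beta,\gamma,\delta\in\mathbb{R}\}$ denotes the (non-commutative) real quaternions, with $i^2=j^2=k^2=ijk=-1$. For $q=\alpha+\beta i+\gamma j+\delta k$, the norm is $|q|=\sqrt{q\bar q}=\sqrt{\alpha^2+\beta^2+\gamma^2+\delta^2}$. The polynomial has its coefficients on the left of the powers of $q$, and $f(q)$ is evaluated by substituting the quaternion $q$ in this expression. *)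

theory Defs
  imports "HOL-Analysis.Analysis"
begin

text \<open>
  The quaternions, set up in the same way as the complex numbers in \<^theory>\<open>HOL.Complex\<close>:
  \<open>Quat \<alpha> \<beta> \<gamma> \<delta>\<close> stands for \<open>\<alpha> + \<beta> i + \<gamma> j + \<delta> k\<close>.
\<close>

codatatype quat = Quat (QRe: real) (QI: real) (QJ: real) (QK: real)

lemma quat_eq_iff: "x = y \<longleftrightarrow> QRe x = QRe y \<and> QI x = QI y \<and> QJ x = QJ y \<and> QK x = QK y"
  by (auto intro: quat.expand)

instantiation quat :: ab_group_add
begin

primcorec zero_quat where
  "QRe 0 = 0"
| "QI 0 = 0"
| "QJ 0 = 0"
| "QK 0 = 0"

primcorec plus_quat where
  "QRe (x + y) = QRe x + QRe y"
| "QI (x + y) = QI x + QI y"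
| "QJ (x + y) = QJ x + QJ y"
| "QK (x + y) = QK x + QK y"

primcorec uminus_quat where
  "QRe (- x) = - QRe x"
| "QI (- x) = - QI x"
| "QJ (- x) = - QJ x"
| "QK (- x) = - QK x"

primcorec minus_quat where
  "QRe (x - y) = QRe x - QRe y"
| "QI (x - y) = QI x - QI y"
| "QJ (x - y) = QJ x - QJ y"
| "QK (x - y) = QK x - QK y"

instance
  by standard (simp_all add: quat_eq_iff)

end

instantiation quat :: ring_1
begin

primcorec one_quat where
  "QRe 1 = 1"
| "QI 1 = 0"
| "QJ 1 = 0"
| "QK 1 = 0"

primcorec times_quat where
  "QRe (x * y) = QRe x * QRe y - QI x * QI y - QJ x * QJ y - QK x * QK y"
| "QI (x * y) = QRe x * QI y + QI x * QRe y + QJ x * QK y - QK x * QJ y"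
| "QJ (x * y) = QRe x * QJ y - QI x * QK y + QJ x * QRe y + QK x * QI y"
| "QK (x * y) = QRe x * QK y + QI x * QJ y - QJ x * QI y + QK x * QRe y"

instance
  by standard (simp_all add: quat_eq_iff algebra_simps)

end

instantiation quat :: real_algebra_1
begin

primcorec scaleR_quat where
  "QRe (scaleR r x) = r * QRe x"
| "QI (scaleR r x) = r * QI x"
| "QJ (scaleR r x) = r * QJ x"
| "QK (scaleR r x) = r * QK x"

instance
  by standard (simp_all add: quat_eq_iff algebra_simps)

end

primcorec quat_cnj :: "quat \<Rightarrow> quat" where
  "QRe (quat_cnj x) = QRe x"
| "QI (quat_cnj x) = - QI x"
| "QJ (quat_cnj x) = - QJ x"
| "QK (quat_cnj x) = - QK x"

instantiation quat :: real_div_algebra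
begin

definition inverse_quat :: "quat \<Rightarrow> quat" where
  "inverse x = quat_cnj x /\<^sub>R ((QRe x)\<^sup>2 + (QI x)\<^sup>2 + (QJ x)\<^sup>2 + (QK x)\<^sup>2)"

definition divide_quat :: "quat \<Rightarrow> quat \<Rightarrow> quat" where
  "x div y = x * inverse y" for x y :: quat

instance
proof
  fix x y :: quat
  let ?N = "(QRe x)\<^sup>2 + (QI x)\<^sup>2 + (QJ x)\<^sup>2 + (QK x)\<^sup>2"
  have mult_cnj: "x * quat_cnj x = ?N *\<^sub>R 1" "quat_cnj x * x = ?N *\<^sub>R 1"
    by (simp_all add: quat_eq_iff power2_eq_square)
  have "?N \<noteq> 0" if "x \<noteq> 0"
    using that by (auto simp: quat_eq_iff add_nonneg_eq_0_iff)
  then show "x \<noteq> 0 \<Longrightarrow> inverse x * x = 1" "x \<noteq> 0 \<Longrightarrow> x * inverse x = 1"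
    by (simp_all add: inverse_quat_def mult_cnj)
  show "x div y = x * inverse y"
    by (rule divide_quat_def)
  show "inverse 0 = (0 :: quat)"
    by (simp add: inverse_quat_def)
qed

end

instantiation quat :: real_normed_div_algebra
begin

definition norm_quat :: "quat \<Rightarrow> real" where
  "norm x = sqrt ((QRe x)\<^sup>2 + (QI x)\<^sup>2 + (QJ x)\<^sup>2 + (QK x)\<^sup>2)"

definition sgn_quat :: "quat \<Rightarrow> quat" where
  "sgn x = x /\<^sub>R norm x" for x :: quat

definition dist_quat :: "quat \<Rightarrow> quat \<Rightarrow> real" where
  "dist x y = norm (x - y)" for x y :: quat

definition uniformity_quat :: "(quat \<times> quat) filter" where
  "(uniformity :: (quat \<times> quat) filter) = (INF e\<in>{0 <..}. principal {(x, y). dist x y < e})"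

definition open_quat :: "quat set \<Rightarrow> bool" where
  "open (U :: quat set) \<longleftrightarrow> (\<forall>x\<in>U. eventually (\<lambda>(x', y). x' = x \<longrightarrow> y \<in> U) uniformity)"

instance
proof
  fix r :: real and x y :: quat and U :: "quat set"
  show "(norm x = 0) = (x = 0)"
    by (auto simp: norm_quat_def quat_eq_iff add_nonneg_eq_0_iff)
  have norm_tuple: "norm z = norm (QRe z, QI z, QJ z, QK z)" for z :: quat
    by (simp add: norm_quat_def norm_Pair add.assoc)
  show "norm (x + y) \<le> norm x + norm y"
    using norm_triangle_ineq[of "(QRe x, QI x, QJ x, QK x)" "(QRe y, QI y, QJ y, QK y)"]
    by (simp add: norm_tuple)
  show "norm (scaleR r x) = \<bar>r\<bar> * norm x"
    by (simp add: norm_quat_def power_mult_distrib distrib_left [symmetric] real_sqrt_mult)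
  show "norm (x * y) = norm x * norm y"
    unfolding norm_quat_def real_sqrt_mult [symmetric] times_quat.sel
    by (rule arg_cong[of _ _ sqrt]) algebra
qed (rule sgn_quat_def dist_quat_def open_quat_def uniformity_quat_def)+

end

definition quat_i :: quat where "quat_i = Quat 0 1 0 0"
definition quat_j :: quat where "quat_j = Quat 0 0 1 0"
definition quat_k :: quat where "quat_k = Quat 0 0 0 1"

lemma Quat_eq:
  "Quat \<alpha> \<beta> \<gamma> \<delta> = of_real \<alpha> + of_real \<beta> * quat_i + of_real \<gamma> * quat_j + of_real \<delta> * quat_k"
  by (simp add: quat_eq_iff of_real_def quat_i_def quat_j_def quat_k_def)

lemma quat_units:
  "quat_i\<^sup>2 = -1" "quat_j\<^sup>2 = -1" "quat_k\<^sup>2 = -1" "quat_i * quat_j * quat_k = -1"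
  by (simp_all add: quat_eq_iff power2_eq_square quat_i_def quat_j_def quat_k_def)

lemma quat_mult_cnj: "q * quat_cnj q = of_real ((norm q)\<^sup>2)"
  by (simp add: quat_eq_iff of_real_def norm_quat_def) (simp add: power2_eq_square)

text \<open>
  The monic polynomial \<open>q ^ n + a (n - 1) * q ^ (n - 1) + \<dots> + a 1 * q + a 0\<close> as a function of
  \<open>q\<close>. Evaluation at \<open>q\<close> is not multiplicative here, and \<open>poly\<close> needs a commutative ring.
\<close>

definition monic_quat_poly :: "nat \<Rightarrow> (nat \<Rightarrow> quat) \<Rightarrow> quat \<Rightarrow> quat" where
  "monic_quat_poly n a q = q ^ n + (\<Sum>k<n. a k * q ^ k)"

end

theory Submission
  imports Defs
begin

text \<open>At a zero \<open>q\<close>, the power \<open>q ^ n\<close> is minus the sum of the lower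
  terms. As the quaternion norm is multiplicative, the triangle inequality turns this into a real
  inequality for \<open>x = norm q\<close>: \<open>x ^ n\<close> is at most the sum of the
  \<open>norm (a k) * x ^ k\<close>. \<open>le_max_sum_root_sum\<close> extracts the bound from it;
  the two arguments of \<open>max\<close> come from the cases \<open>x\<close> \<ge> 1 and
  \<open>x\<close> < 1.\<close>

lemma le_max_sum_root_sum:
  fixes x :: real and b :: "nat \<Rightarrow> real"
  assumes "n \<ge> 1" and "x \<ge> 0" and b: "\<And>k. k < n \<Longrightarrow> b k \<ge> 0"
    and le: "x ^ n \<le> (\<Sum>k<n. b k * x ^ k)"
  shows "x \<le> max (\<Sum>k<n. b k) (root n (\<Sum>k<n. b k))"
proof (cases "x \<ge> 1")
  case True
  have "x * x ^ (n - 1) = x ^ n"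
    using \<open>n \<ge> 1\<close> by (simp add: power_eq_if)
  \<comment> \<open>For \<open>x\<close> \<ge> 1 the top lower power \<open>x ^ (n - 1)\<close>
    dominates all others; cancelling it against \<open>x ^ n\<close> leaves one factor
    \<open>x\<close>.\<close>
  also have "\<dots> \<le> (\<Sum>k<n. b k * x ^ (n - 1))"
    using True by (intro order_trans[OF le] sum_mono mult_left_mono power_increasing) (auto simp: b)
  also have "\<dots> = (\<Sum>k<n. b k) * x ^ (n - 1)"
    by (simp add: sum_distrib_right)
  finally have "x \<le> (\<Sum>k<n. b k)"
    using True by simp
  then show ?thesis
    by simp
next
  case False
  \<comment> \<open>For 0 \<le> \<open>x\<close> < 1 every \<open>x ^ k\<close> is at most 1, so
    \<open>x ^ n\<close> itself is bounded by the coefficient sum.\<close>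
  have "(\<Sum>k<n. b k * x ^ k) \<le> (\<Sum>k<n. b k)"
    using False \<open>x \<ge> 0\<close> by (intro sum_mono mult_left_le power_le_one) (auto simp: b)
  with le have "x ^ n \<le> (\<Sum>k<n. b k)"
    by simp
  then have "root n (x ^ n) \<le> root n (\<Sum>k<n. b k)"
    using \<open>n \<ge> 1\<close> by simp
  then show ?thesis
    using \<open>n \<ge> 1\<close> \<open>x \<ge> 0\<close> by (simp add: real_root_power_cancel)
qed

theorem theorem2:
  fixes n :: nat and a :: "nat \<Rightarrow> quat" and L :: real
  assumes "n \<ge> 1"
    and "L = (\<Sum>k<n. norm (a k))"
  shows "\<forall>q. monic_quat_poly n a q = 0 \<longrightarrow> norm q \<le> max L (root n L)"
proof (intro allI impI)
  fix q
  assume "monic_quat_poly n a q = 0"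
  then have "q ^ n = - (\<Sum>k<n. a k * q ^ k)"
    by (simp add: monic_quat_poly_def eq_neg_iff_add_eq_0)
  \<comment> \<open>Taking norms removes the sign and, by multiplicativity, pulls the power
    out.\<close>
  then have "norm q ^ n = norm (\<Sum>k<n. a k * q ^ k)"
    by (simp flip: norm_power)
  also have "\<dots> \<le> (\<Sum>k<n. norm (a k) * norm q ^ k)"
    by (rule sum_norm_le) (simp add: norm_mult norm_power)
  finally show "norm q \<le> max L (root n L)"
    unfolding \<open>L = _\<close> using \<open>n \<ge> 1\<close> by (intro le_max_sum_root_sum) auto
qed

end
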